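(* Let $d \geq 3$, let $F_1(\mathbf{x}_1),\dotsc,F_k(\mathbf{x}_k)$ be nonzero $d$-forms over $\mathbb{C}$ in independent tuples of variables $\mathbf{x}_1,\dotsc,\mathbf{x}_k$, and let $F = F_1 + \dotsb + F_k$. Suppose that for each $i$, $1 \leq i \leq k$, $$\operatorname{rk}(F_i) = \max\{ \dim(W) + \operatorname{minrank}(W) : 0 \notin W \subset \operatorname{Derivs}(F_i)_2 \},$$ the maximum taken over all nonlinear affine subspaces $W$ of $\operatorname{Derivs}(F_i)_2$. Then $$\operatorname{rk}(F) = \max\{ \dim(W) + \operatorname{minrank}(W) : 0 \notin W \subset \operatorname{Derivs}(F)_2 \},$$ the maximum taken over all nonlinear affine subspaces $W$ of $\operatorname{Derivs}(F)_2$, and $\operatorname{rk}(F) = \operatorname{rk}(F_1) + \dotsb + \operatorname{rk}(F_k)$.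
   Context: All polynomials have complex coefficients. A $d$-form is a homogeneous polynomial of degree $d$. Tuples of variables are independent if they consist of pairwise disjoint sets of variables of one polynomial ring. The Waring rank $\operatorname{rk}(F)$ of a $d$-form $F$ is the least $r$ such that $F = \ell_1^d + \dotsb + \ell_r^d$ for some linear forms $\ell_1,\dotsc,\ell_r$. $\operatorname{Derivs}(F)_a$ is the vector space of $a$-forms spanned by the $(d-a)$th order partial derivatives of the $d$-form $F$. An affine subspace is a translate of a linear subspace; a nonlinear affine subspace is an affine subspace that does not contain the origin $0$. For an affine subspace $W$ of a space of $a$-forms, $\operatorname{minrank}(W) = \min\{\operatorname{rk}(G) : G \in W\}$, where $\operatorname{rk}(G)$ is the Waring rank of the $a$-form $G$. *)

theory Defs
  imports Complex_Main "HOL-Library.Poly_Mapping" "HOL-Library.Disjoint_Sets"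
begin

text \<open>The polynomial ring over the complex numbers whose variables are the elements of \<^typ>\<open>'v\<close>:
  finitely supported maps from monomials (finitely supported exponent maps) to coefficients, with
  the convolution product of \<^theory>\<open>HOL-Library.Poly_Mapping\<close>.\<close>

type_synonym 'v cpoly = "('v \<Rightarrow>\<^sub>0 nat) \<Rightarrow>\<^sub>0 complex"

definition cscale :: "complex \<Rightarrow> 'v cpoly \<Rightarrow> 'v cpoly" where
  "cscale c p = Poly_Mapping.single 0 c * p"

interpretation cpoly: vector_space cscale
  by unfold_locales
    (simp_all add: cscale_def algebra_simps single_add mult_single flip: mult.assoc)

definition poly_vars :: "'v cpoly \<Rightarrow> 'v set" where
  "poly_vars p = (\<Union>m\<in>Poly_Mapping.keys p. Poly_Mapping.keys m)"

definition monom_degree :: "('v \<Rightarrow>\<^sub>0 nat) \<Rightarrow> nat" where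
  "monom_degree m = (\<Sum>v\<in>Poly_Mapping.keys m. Poly_Mapping.lookup m v)"

text \<open>As usual, the zero polynomial is a form of every degree.\<close>

definition is_form :: "nat \<Rightarrow> 'v cpoly \<Rightarrow> bool" where
  "is_form d p \<longleftrightarrow> (\<forall>m\<in>Poly_Mapping.keys p. monom_degree m = d)"

text \<open>The degree is an explicit argument, since it cannot be recovered from the zero form.\<close>

definition waring_rank :: "nat \<Rightarrow> 'v cpoly \<Rightarrow> nat" where
  "waring_rank d p =
     (LEAST r. \<exists>l :: nat \<Rightarrow> 'v cpoly. (\<forall>j\<in>{1..r}. is_form 1 (l j)) \<and> p = (\<Sum>j=1..r. l j ^ d))"

text \<open>The subtraction of exponents is truncated, but only in terms whose coefficient is zero.\<close>

definition partial_deriv :: "'v \<Rightarrow> 'v cpoly \<Rightarrow> 'v cpoly" where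
  "partial_deriv v p = (\<Sum>m\<in>Poly_Mapping.keys p.
     Poly_Mapping.single (m - Poly_Mapping.single v 1)
       (of_nat (Poly_Mapping.lookup m v) * Poly_Mapping.lookup p m))"

text \<open>\<open>Derivs d p a\<close> is the space of \<open>a\<close>-forms spanned by the partial derivatives of
  order \<open>d - a\<close> of the \<open>d\<close>-form \<open>p\<close>; it is meant for \<open>a \<le> d\<close>.\<close>

definition Derivs :: "nat \<Rightarrow> 'v cpoly \<Rightarrow> nat \<Rightarrow> 'v cpoly set" where
  "Derivs d p a = cpoly.span {foldr partial_deriv vs p | vs. length vs = d - a}"

definition affine_subspace :: "'v cpoly set \<Rightarrow> bool" where
  "affine_subspace W \<longleftrightarrow> (\<exists>p V. cpoly.subspace V \<and> W = (\<lambda>q. p + q) ` V)"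

text \<open>The dimension of an affine subspace is that of the linear subspace it is a translate of,
  which is the set of differences of its elements.\<close>

definition affine_dim :: "'v cpoly set \<Rightarrow> nat" where
  "affine_dim W = cpoly.dim {p - q | p q. p \<in> W \<and> q \<in> W}"

lemma affine_dim_translate:
  assumes "cpoly.subspace V"
  shows "affine_dim ((\<lambda>q. p + q) ` V) = cpoly.dim V"
proof -
  have "{a - b | a b. a \<in> (\<lambda>q. p + q) ` V \<and> b \<in> (\<lambda>q. p + q) ` V} = V" (is "?D = V")
  proof
    show "?D \<subseteq> V"
      using cpoly.subspace_diff[OF assms] by auto
    show "V \<subseteq> ?D"
    proof
      fix x assume "x \<in> V"
      moreover have "x = (p + x) - (p + 0)" by simp
      ultimately show "x \<in> ?D"
        using cpoly.subspace_0[OF assms] by blast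
    qed
  qed
  then show ?thesis
    by (simp add: affine_dim_def)
qed

text \<open>The infimum is over a set of natural numbers, so it is attained when \<open>W\<close> is nonempty.\<close>

definition minrank :: "nat \<Rightarrow> 'v cpoly set \<Rightarrow> nat" where
  "minrank a W = Inf (waring_rank a ` W)"

end

theory Submission imports Defs begin

text \<open>Every form of positive degree has a Waring decomposition, so ranks are attained and are subadditive
  (\<open>waring_sum_waring_rank\<close>). If \<open>F = \<Sum>\<^sub>j l\<^sub>j\<^sup>d\<close> with \<open>r\<close> summands, then the derivatives of \<open>F\<close> of degree
  2 are combinations of the squares \<open>l\<^sub>j\<^sup>2\<close>. An affine space \<open>W\<close> of such derivatives contains a
  combination of at most \<open>r - dim W\<close> of these squares, whence \<open>dim W + minrank W \<le> r\<close>
  (\<open>waring_sum_lower_bound\<close>). The maximum in the theorem is therefore a lower bound for the rank of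
  every nonzero form, and it has to be shown that its sharpness passes to sums in independent variables.

  By induction on the number of summands it suffices to treat a sum \<open>F + G\<close>. Let \<open>W\<^sub>1\<close> and \<open>W\<^sub>2\<close> be
  affine spaces of quadratic derivatives of \<open>F\<close> and \<open>G\<close> that attain the two ranks. As \<open>d \<ge> 3\<close>,
  derivatives of order \<open>d - 2\<close> by the variables of one summand kill the other, so
  \<open>W = W\<^sub>1 + W\<^sub>2\<close> consists of derivatives of \<open>F + G\<close>. It does not contain zero, its dimension is the
  sum of the two dimensions, and its minimal rank is at least the sum of the two minimal ranks, because the
  Waring rank of quadratic forms is additive in independent variables
  (\<open>waring_rank_quadratic_add\<close>). Hence
  \<open>rk F + rk G \<le> dim W + minrank W \<le> rk (F + G) \<le> rk F + rk G\<close>, and equality holds throughout.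

  The additivity for quadratic forms rests on two facts: a quadratic form in \<open>n\<close> linear forms is a sum
  of \<open>n\<close> squares (\<open>waring_sum_quadratic\<close>), and \<open>r\<close> squares that add up to \<open>p + q\<close> present \<open>p\<close> and
  \<open>q\<close> as quadratic forms in altogether \<open>r\<close> linear forms (\<open>waring_sum_quadratic_split\<close>).\<close>

section \<open>Scalars, monomials and degrees\<close>

lemma cscale_times_left: "cscale c p * q = cscale c (p * q)"
  by (simp add: cscale_def mult.assoc)

lemma cscale_times_right: "p * cscale c q = cscale c (p * q)"
  by (simp add: cscale_def algebra_simps)

lemma cscale_power: "cscale c p ^ n = cscale (c ^ n) (p ^ n)"
  by (induction n)
    (simp_all add: cscale_times_left cscale_times_right cpoly.scale_scale del: cpoly.scale_one, simp)

lemma lookup_cscale: "Poly_Mapping.lookup (cscale c p) m = c * Poly_Mapping.lookup p m"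
  unfolding cscale_def mult_map_scale_conv_mult[symmetric]
  by transfer (simp add: when_def)

lemma of_nat_eq_cscale: "of_nat n * p = cscale (of_nat n) p"
  by (simp add: cscale_def single_of_nat)

lemma poly_as_sum_of_monomials:
  "(\<Sum>m\<in>Poly_Mapping.keys p. cscale (Poly_Mapping.lookup p m) (Poly_Mapping.single m 1)) = (p :: 'v cpoly)"
proof (rule poly_mapping_eqI)
  fix n
  show "Poly_Mapping.lookup (\<Sum>m\<in>Poly_Mapping.keys p. cscale (Poly_Mapping.lookup p m) (Poly_Mapping.single m 1)) n
      = Poly_Mapping.lookup p n"
    by (simp add: lookup_sum lookup_cscale lookup_single when_def sum.delta in_keys_iff if_distrib cong: if_cong)
qed

lemma cpoly_induct [case_names zero monomial add]:
  fixes p :: "'v cpoly"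
  assumes "P 0" "\<And>m c. P (Poly_Mapping.single m c)" "\<And>p q. P p \<Longrightarrow> P q \<Longrightarrow> P (p + q)"
  shows "P p"
proof -
  have "P (\<Sum>m\<in>A. cscale (Poly_Mapping.lookup p m) (Poly_Mapping.single m 1))" if "finite A" for A
    using that by (induction A) (simp_all add: assms cscale_def mult_single)
  from this[of "Poly_Mapping.keys p"] show ?thesis
    by (simp add: poly_as_sum_of_monomials)
qed

lemma monom_degree_add: "monom_degree (m + n) = monom_degree m + monom_degree n"
  unfolding monom_degree_def by (rule setsum_keys_plus_distrib) auto

lemma monom_degree_single [simp]: "monom_degree (Poly_Mapping.single v k) = k"
  by (simp add: monom_degree_def)

lemma monom_degree_0 [simp]: "monom_degree 0 = 0"
  by (simp add: monom_degree_def)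

lemma keys_add_nat: "Poly_Mapping.keys (m + n) = Poly_Mapping.keys m \<union> Poly_Mapping.keys (n :: 'v \<Rightarrow>\<^sub>0 nat)"
  by (auto simp: in_keys_iff lookup_add)

lemma monomial_split_var:
  assumes "Poly_Mapping.lookup m v > (0::nat)"
  shows "m = Poly_Mapping.single v 1 + (m - Poly_Mapping.single v 1)"
  using assms by (intro poly_mapping_eqI) (auto simp: lookup_add lookup_minus lookup_single when_def)

lemma monom_degree_Suc_split:
  assumes "monom_degree m = Suc n"
  obtains v m' where "m = Poly_Mapping.single v 1 + m'" "monom_degree m' = n"
proof -
  have "\<exists>v\<in>Poly_Mapping.keys m. Poly_Mapping.lookup m v > 0"
    using assms unfolding monom_degree_def
    by (metis Zero_not_Suc gr0I sum.neutral)
  then obtain v where v: "Poly_Mapping.lookup m v > 0"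
    by blast
  note s = monomial_split_var[OF v]
  have "monom_degree m = 1 + monom_degree (m - Poly_Mapping.single v 1)"
    by (subst s) (simp add: monom_degree_add)
  with s assms show thesis
    by (intro that) auto
qed

section \<open>Forms in prescribed variables\<close>

text \<open>The space of \<open>d\<close>-forms involving only variables from \<open>A\<close>.\<close>

definition forms :: "nat \<Rightarrow> 'v set \<Rightarrow> 'v cpoly set" where
  "forms d A = {p. is_form d p \<and> poly_vars p \<subseteq> A}"

lemma forms_iff: "p \<in> forms d A \<longleftrightarrow> (\<forall>m\<in>Poly_Mapping.keys p. monom_degree m = d \<and> Poly_Mapping.keys m \<subseteq> A)"
  by (auto simp: forms_def is_form_def poly_vars_def)

lemma forms_UNIV [simp]: "forms d UNIV = Collect (is_form d)"
  by (auto simp: forms_def)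

lemma subspace_forms: "cpoly.subspace (forms d A)"
proof (rule cpoly.subspaceI)
  show "p + q \<in> forms d A" if "p \<in> forms d A" "q \<in> forms d A" for p q
    using that keys_add[of p q] by (auto simp: forms_iff)
  show "cscale c p \<in> forms d A" if "p \<in> forms d A" for c p
    using that by (auto simp: forms_iff in_keys_iff lookup_cscale)
qed (simp add: forms_iff)

lemma forms_mono: "A \<subseteq> B \<Longrightarrow> forms d A \<subseteq> forms d B"
  by (fastforce simp: forms_iff)

text \<open>The hypothesis \<open>d > 0\<close> matters: constants lie in \<^term>\<open>forms 0 A\<close> for every \<open>A\<close>.\<close>

lemma forms_disjoint:
  assumes "p \<in> forms d A" "p \<in> forms d B" "A \<inter> B = {}" "d > 0"
  shows "p = 0"
proof -
  have False if "m \<in> Poly_Mapping.keys p" for m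
  proof -
    have "Poly_Mapping.keys m \<subseteq> {}" "monom_degree m = d"
      using assms(1-3) that unfolding forms_iff by blast+
    with \<open>d > 0\<close> show False by (simp add: monom_degree_def)
  qed
  then show ?thesis by (metis all_not_in_conv keys_eq_empty)
qed

section \<open>Partial derivatives\<close>

lemma partial_deriv_add: "partial_deriv v (p + q) = partial_deriv v p + partial_deriv v q"
  unfolding partial_deriv_def
  by (rule setsum_keys_plus_distrib) (simp_all add: single_add ring_distribs)

lemma partial_deriv_0 [simp]: "partial_deriv v 0 = 0"
  by (simp add: partial_deriv_def)

lemma partial_deriv_single:
  "partial_deriv v (Poly_Mapping.single m c) =
    Poly_Mapping.single (m - Poly_Mapping.single v 1) (of_nat (Poly_Mapping.lookup m v) * c)"
  by (cases "c = 0") (simp_all add: partial_deriv_def)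

lemma partial_deriv_times:
  "partial_deriv v (p * q) = partial_deriv v p * q + p * partial_deriv v q"
proof (induction p rule: cpoly_induct)
  case (monomial m c)
  show ?case
  proof (induction q rule: cpoly_induct)
    case (monomial n e)
    have L: "Poly_Mapping.single (m + n - Poly_Mapping.single v 1) (of_nat (Poly_Mapping.lookup m v) * c * e) =
       Poly_Mapping.single (m - Poly_Mapping.single v 1 + n) (of_nat (Poly_Mapping.lookup m v) * c * e)" for m n c e
    proof (cases "Poly_Mapping.lookup m v = 0")
      case False
      then have "m + n - Poly_Mapping.single v 1 = m - Poly_Mapping.single v 1 + n"
        by (intro poly_mapping_eqI) (auto simp: lookup_add lookup_minus lookup_single when_def)
      then show ?thesis by simp
    qed simp
    show ?case
      using L[of m n c e] L[of n m e c]
      by (simp add: mult_single partial_deriv_single lookup_add single_add algebra_simps)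
  qed (simp_all add: partial_deriv_add algebra_simps)
qed (simp_all add: partial_deriv_add algebra_simps)

lemma partial_deriv_const [simp]: "partial_deriv v (Poly_Mapping.single 0 c) = 0"
  by (simp add: partial_deriv_single)

lemma partial_deriv_cscale: "partial_deriv v (cscale c p) = cscale c (partial_deriv v p)"
  by (simp add: cscale_def partial_deriv_times)

lemma partial_deriv_sum: "partial_deriv v (sum f I) = (\<Sum>i\<in>I. partial_deriv v (f i))"
  by (induction I rule: infinite_finite_induct) (simp_all add: partial_deriv_add)

lemma lookup_partial_deriv:
  "Poly_Mapping.lookup (partial_deriv v p) m = of_nat (Suc (Poly_Mapping.lookup m v)) * Poly_Mapping.lookup p (m + Poly_Mapping.single v 1)"
proof (induction p rule: cpoly_induct)
  case (monomial n c)
  show ?case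
  proof (cases "Poly_Mapping.lookup n v = 0")
    case True
    then have "n \<noteq> m + Poly_Mapping.single v 1"
      by (metis One_nat_def add_is_0 lookup_add lookup_single_eq one_neq_zero)
    with True show ?thesis by (simp add: partial_deriv_single lookup_single when_def)
  next
    case False
    then have "n - Poly_Mapping.single v 1 = m \<longleftrightarrow> n = m + Poly_Mapping.single v 1"
      using monomial_split_var[of n v] by (auto simp: add.commute)
    with False show ?thesis
      by (auto simp: partial_deriv_single lookup_single when_def lookup_add)
  qed
qed (simp_all add: partial_deriv_add lookup_add algebra_simps)

lemma partial_deriv_forms: "p \<in> forms d A \<Longrightarrow> partial_deriv v p \<in> forms (d - 1) A"
  unfolding forms_iff
proof
  fix m
  assume p: "\<forall>m\<in>Poly_Mapping.keys p. monom_degree m = d \<and> Poly_Mapping.keys m \<subseteq> A"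
    and m: "m \<in> Poly_Mapping.keys (partial_deriv v p)"
  from m have "m + Poly_Mapping.single v 1 \<in> Poly_Mapping.keys p"
    by (simp add: in_keys_iff lookup_partial_deriv)
  with p have "monom_degree (m + Poly_Mapping.single v 1) = d"
    "Poly_Mapping.keys (m + Poly_Mapping.single v 1) \<subseteq> A"
    by blast+
  then show "monom_degree m = d - 1 \<and> Poly_Mapping.keys m \<subseteq> A"
    by (auto simp: monom_degree_add keys_add_nat)
qed

lemma partial_deriv_other_var: "p \<in> forms d A \<Longrightarrow> v \<notin> A \<Longrightarrow> partial_deriv v p = 0"
proof (rule poly_mapping_eqI)
  fix m
  assume "p \<in> forms d A" "v \<notin> A"
  then have "m + Poly_Mapping.single v 1 \<notin> Poly_Mapping.keys p"
    using keys_add_nat[of m "Poly_Mapping.single v 1"] unfolding forms_iff by fastforce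
  then show "Poly_Mapping.lookup (partial_deriv v p) m = Poly_Mapping.lookup 0 m"
    by (simp add: lookup_partial_deriv in_keys_iff)
qed

lemma partial_deriv_all_zero:
  assumes "p \<in> forms (Suc d) A" "\<And>v. v \<in> A \<Longrightarrow> partial_deriv v p = 0"
  shows "p = 0"
proof -
  have False if m: "m \<in> Poly_Mapping.keys p" for m
  proof -
    from assms(1) m have deg: "monom_degree m = Suc d" and km: "Poly_Mapping.keys m \<subseteq> A"
      by (auto simp: forms_iff)
    obtain v m' where "m = Poly_Mapping.single v 1 + m'"
      using deg by (rule monom_degree_Suc_split)
    with assms(2)[of v] km have "Poly_Mapping.lookup (partial_deriv v p) m' = 0"
      by (auto simp: keys_add_nat)
    with m \<open>m = _\<close> show False
      by (simp add: lookup_partial_deriv in_keys_iff add.commute del: of_nat_Suc)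
  qed
  then show ?thesis by (metis all_not_in_conv keys_eq_empty)
qed

section \<open>Setting variables to zero\<close>

lemma forms_0_const:
  assumes "p \<in> forms 0 A"
  obtains c where "p = Poly_Mapping.single 0 c"
proof
  show "p = Poly_Mapping.single 0 (Poly_Mapping.lookup p 0)"
  proof (rule poly_mapping_eqI)
    fix m
    have "m = 0" if "m \<in> Poly_Mapping.keys p"
    proof -
      have "monom_degree m = 0" using assms that by (simp add: forms_iff)
      then show ?thesis
        by (intro poly_mapping_eqI) (simp add: monom_degree_def in_keys_iff)
    qed
    then show "Poly_Mapping.lookup p m = Poly_Mapping.lookup (Poly_Mapping.single 0 (Poly_Mapping.lookup p 0)) m"
      by (auto simp: lookup_single when_def in_keys_iff)
  qed
qed

text \<open>The image of \<open>p\<close> under the ring endomorphism that sets all variables outside \<open>A\<close> to zero: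
  only the monomials in the variables of \<open>A\<close> survive.\<close>

definition restrict_vars :: "'v set \<Rightarrow> 'v cpoly \<Rightarrow> 'v cpoly" where
  "restrict_vars A p = (\<Sum>m\<in>Poly_Mapping.keys p.
     if Poly_Mapping.keys m \<subseteq> A then Poly_Mapping.single m (Poly_Mapping.lookup p m) else 0)"

lemma restrict_vars_0 [simp]: "restrict_vars A 0 = 0"
  by (simp add: restrict_vars_def)

lemma restrict_vars_add: "restrict_vars A (p + q) = restrict_vars A p + restrict_vars A q"
  unfolding restrict_vars_def
  by (rule setsum_keys_plus_distrib) (simp_all add: single_add)

lemma restrict_vars_sum: "restrict_vars A (sum f I) = (\<Sum>i\<in>I. restrict_vars A (f i))"
  by (induction I rule: infinite_finite_induct) (simp_all add: restrict_vars_add)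

lemma restrict_vars_single:
  "restrict_vars A (Poly_Mapping.single m c) = (if Poly_Mapping.keys m \<subseteq> A then Poly_Mapping.single m c else 0)"
  by (cases "c = 0") (simp_all add: restrict_vars_def)

lemma restrict_vars_times: "restrict_vars A (p * q) = restrict_vars A p * restrict_vars A q"
proof (induction p rule: cpoly_induct)
  case (monomial m c)
  show ?case
    by (induction q rule: cpoly_induct)
      (simp_all add: mult_single restrict_vars_single keys_add_nat restrict_vars_add ring_distribs)
qed (simp_all add: restrict_vars_add ring_distribs)

lemma lookup_restrict_vars:
  "Poly_Mapping.lookup (restrict_vars A p) m = (if Poly_Mapping.keys m \<subseteq> A then Poly_Mapping.lookup p m else 0)"
proof (induction p rule: cpoly_induct)
  case (monomial n c)
  then show ?case by (cases "n = m") (simp_all add: restrict_vars_single lookup_single)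
qed (simp_all add: restrict_vars_add lookup_add)

lemma restrict_vars_forms: "is_form d p \<Longrightarrow> restrict_vars A p \<in> forms d A"
  by (simp add: forms_iff is_form_def Ball_def in_keys_iff lookup_restrict_vars)

lemma restrict_vars_same:
  assumes "p \<in> forms d A"
  shows "restrict_vars A p = p"
proof (rule poly_mapping_eqI)
  show "Poly_Mapping.lookup (restrict_vars A p) m = Poly_Mapping.lookup p m" for m
    using assms unfolding forms_iff lookup_restrict_vars by (cases "Poly_Mapping.keys m \<subseteq> A") (auto simp: in_keys_iff)
qed

lemma restrict_vars_disjoint:
  assumes "p \<in> forms d B" "A \<inter> B = {}" "d > 0"
  shows "restrict_vars A p = 0"
proof (rule forms_disjoint[of _ d A B])
  have "is_form d p" using assms(1) by (simp add: forms_def)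
  then show "restrict_vars A p \<in> forms d A" by (rule restrict_vars_forms)
  show "restrict_vars A p \<in> forms d B"
    using assms(1) by (simp add: forms_iff Ball_def in_keys_iff lookup_restrict_vars)
qed (use assms in auto)

lemma linear_form_split_vars:
  assumes "is_form 1 l"
  shows "l = restrict_vars A l + restrict_vars (- A) l"
proof (rule poly_mapping_eqI)
  fix m
  show "Poly_Mapping.lookup l m = Poly_Mapping.lookup (restrict_vars A l + restrict_vars (- A) l) m"
  proof (cases "m \<in> Poly_Mapping.keys l")
    case True
    with assms have "monom_degree m = Suc 0" by (simp add: is_form_def)
    then obtain v m' where m: "m = Poly_Mapping.single v 1 + m'" "monom_degree m' = 0"
      by (rule monom_degree_Suc_split)
    then have "m' = 0"
      by (intro poly_mapping_eqI) (simp add: monom_degree_def in_keys_iff)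
    with m have "Poly_Mapping.keys m = {v}" by simp
    then show ?thesis by (simp add: lookup_add lookup_restrict_vars)
  qed (simp add: in_keys_iff lookup_add lookup_restrict_vars)
qed

section \<open>Sums of powers of linear forms\<close>

text \<open>\<open>p\<close> is a sum of \<open>r\<close> powers \<open>l\<^sup>d\<close> of linear forms, so that the Waring rank is the least such
  \<open>r\<close>. Zero linear forms are permitted, hence for \<open>d > 0\<close> the property is monotone in \<open>r\<close>.\<close>

definition waring_sum :: "nat \<Rightarrow> nat \<Rightarrow> 'v cpoly \<Rightarrow> bool" where
  "waring_sum d r p \<longleftrightarrow>
     (\<exists>l :: nat \<Rightarrow> 'v cpoly. (\<forall>j\<in>{1..r}. is_form 1 (l j)) \<and> p = (\<Sum>j=1..r. l j ^ d))"

lemma waring_rank_le: "waring_sum d r p \<Longrightarrow> waring_rank d p \<le> r"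
  unfolding waring_rank_def waring_sum_def by (rule Least_le)

lemma waring_sum_0: "waring_sum d 0 0"
  by (simp add: waring_sum_def)

lemma waring_sum_Suc:
  assumes "waring_sum d r p" "is_form 1 l"
  shows "waring_sum d (Suc r) (p + l ^ d)"
proof -
  obtain f where f: "\<forall>j\<in>{1..r}. is_form 1 (f j)" "p = (\<Sum>j=1..r. f j ^ d)"
    using assms(1) by (auto simp: waring_sum_def)
  have "(\<Sum>j=1..r. (f(Suc r := l)) j ^ d) = p"
    unfolding f(2) by (intro sum.cong) auto
  then have "p + l ^ d = (\<Sum>j=1..Suc r. (f(Suc r := l)) j ^ d)"
    by simp
  moreover have "\<forall>j\<in>{1..Suc r}. is_form 1 ((f(Suc r := l)) j)"
    using f(1) assms(2) by auto
  ultimately show ?thesis unfolding waring_sum_def by blast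
qed

lemma waring_sum_add:
  assumes p: "waring_sum d r p" and q: "waring_sum d s q"
  shows "waring_sum d (r + s) (p + q)"
proof -
  obtain f where f: "\<forall>j\<in>{1..s}. is_form 1 (f j)" "q = (\<Sum>j=1..s. f j ^ d)"
    using q by (auto simp: waring_sum_def)
  have "waring_sum d (r + n) (p + (\<Sum>j=1..n. f j ^ d))" if "n \<le> s" for n
    using that
  proof (induction n)
    case (Suc n)
    then show ?case
      using waring_sum_Suc[of d "r + n" "p + (\<Sum>j=1..n. f j ^ d)" "f (Suc n)"] f(1)
      by (simp add: add.assoc)
  qed (simp add: p)
  with f(2) show ?thesis by simp
qed

lemma waring_sum_mono:
  assumes "waring_sum d r p" "r \<le> s" "d > 0"
  shows "waring_sum d s p"
  using assms(2)
proof (induction rule: dec_induct)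
  case (step n)
  then show ?case
    using waring_sum_Suc[of d n p 0] \<open>d > 0\<close> by (simp add: is_form_def power_0_left)
qed (rule assms(1))

lemma waring_sum_power: "is_form 1 l \<Longrightarrow> waring_sum d 1 (l ^ d)"
  using waring_sum_Suc[OF waring_sum_0] by simp

lemma complex_root_exists:
  fixes c :: complex
  assumes "n > 0"
  obtains z where "z ^ n = c"
proof
  show "rcis (root n (cmod c)) (Arg c / real n) ^ n = c"
    using assms by (simp add: DeMoivre2 rcis_cmod_Arg)
qed

lemma is_form_cscale: "is_form d p \<Longrightarrow> is_form d (cscale c p)"
  using cpoly.subspace_scale[OF subspace_forms[of d UNIV]] by simp

lemma is_form_add: "is_form d p \<Longrightarrow> is_form d q \<Longrightarrow> is_form d (p + q)"
  using cpoly.subspace_add[OF subspace_forms[of d UNIV]] by simp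

lemma waring_sum_cscale_power:
  assumes "is_form 1 l" "d > 0"
  shows "waring_sum d 1 (cscale c (l ^ d))"
proof -
  obtain z where "z ^ d = c" using \<open>d > 0\<close> by (rule complex_root_exists)
  then have "cscale c (l ^ d) = cscale z l ^ d" by (simp add: cscale_power)
  then show ?thesis
    using waring_sum_power[OF is_form_cscale[OF assms(1)]] by metis
qed

lemma waring_sum_span:
  assumes fin: "finite T" and T: "T \<subseteq> {l ^ d | l. is_form 1 l}" and p: "p \<in> cpoly.span T" and "d > 0"
  shows "waring_sum d (card T) p"
proof -
  obtain u where u: "p = (\<Sum>t\<in>T. cscale (u t) t)"
    using p by (auto simp: cpoly.span_finite[OF fin])
  have "waring_sum d (card S) (\<Sum>t\<in>S. cscale (u t) t)" if "S \<subseteq> T" for S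
    using finite_subset[OF that fin] that
  proof (induction S)
    case (insert t S)
    obtain l where l: "t = l ^ d" "is_form 1 l" using insert.prems T by auto
    have "waring_sum d (1 + card S) (cscale (u t) t + (\<Sum>t\<in>S. cscale (u t) t))"
      unfolding l(1) using insert l \<open>d > 0\<close> by (intro waring_sum_add waring_sum_cscale_power) auto
    with insert show ?case by simp
  qed (simp add: waring_sum_0)
  with u show ?thesis by simp
qed

text \<open>If all values at scalars \<open>t\<close> of a polynomial in \<open>t\<close> with coefficients \<open>f i\<close> lie in a subspace,
  then so do its coefficients. Combining the values at \<open>2t\<close> and \<open>t\<close> eliminates the leading
  coefficient and multiplies the others by nonzero scalars.\<close>

lemma coeffs_in_subspace:
  fixes f :: "nat \<Rightarrow> 'v cpoly"
  assumes U: "cpoly.subspace U" and "\<And>t. (\<Sum>i\<le>n. cscale (t ^ i) (f i)) \<in> U" and "i \<le> n"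
  shows "f i \<in> U"
  using assms(2,3)
proof (induction n arbitrary: f i)
  case 0
  then show ?case using 0(1)[of 1] by simp
next
  case (Suc n)
  have low: "f i \<in> U" if "i \<le> n" for i
  proof -
    \<comment> \<open>the coefficients of the polynomial at \<open>2t\<close> minus \<open>2\<^bsup>n+1\<^esup>\<close> times the polynomial at \<open>t\<close>\<close>
    define g where "g = (\<lambda>i. cscale (2 ^ i - 2 ^ Suc n) (f i))"
    have "(\<Sum>i\<le>n. cscale (t ^ i) (g i)) \<in> U" for t
    proof -
      have "cscale (t ^ i) (g i) = cscale ((2 * t) ^ i) (f i) - cscale (2 ^ Suc n) (cscale (t ^ i) (f i))" for i
        unfolding g_def power_mult_distrib cpoly.scale_scale cpoly.scale_left_diff_distrib[symmetric]
        by (simp add: algebra_simps del: power_Suc)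
      moreover have "(\<Sum>i\<le>n. cscale (t ^ i) (g i)) = (\<Sum>i\<le>Suc n. cscale (t ^ i) (g i))"
        by (simp add: g_def)
      ultimately have "(\<Sum>i\<le>n. cscale (t ^ i) (g i)) =
          (\<Sum>i\<le>Suc n. cscale ((2 * t) ^ i) (f i)) - cscale (2 ^ Suc n) (\<Sum>i\<le>Suc n. cscale (t ^ i) (f i))"
        by (simp only: sum_subtractf cpoly.scale_sum_right)
      also have "\<dots> \<in> U"
        by (intro cpoly.subspace_diff[OF U] cpoly.subspace_scale[OF U] Suc.prems)
      finally show ?thesis .
    qed
    then have "g i \<in> U" using that by (rule Suc.IH)
    then have "cscale (inverse (2 ^ i - 2 ^ Suc n)) (g i) \<in> U"
      by (rule cpoly.subspace_scale[OF U])
    moreover have "(2::complex) ^ i \<noteq> 2 ^ Suc n"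
    proof
      assume "(2::complex) ^ i = 2 ^ Suc n"
      then have "cmod (2 ^ i) = cmod (2 ^ Suc n)" by (rule arg_cong)
      then have "(2::real) ^ i = 2 ^ Suc n" by (simp only: norm_power norm_numeral)
      then have "i = Suc n" by (subst (asm) power_inject_exp) simp_all
      with that show False by simp
    qed
    ultimately show ?thesis by (simp add: g_def)
  qed
  have "f (Suc n) = (\<Sum>i\<le>Suc n. cscale (1 ^ i) (f i)) - (\<Sum>i\<le>n. f i)"
    by simp
  also have "\<dots> \<in> U"
    by (intro cpoly.subspace_diff[OF U] cpoly.subspace_sum[OF U] Suc.prems low) auto
  finally show ?case using low Suc.prems(2) by (cases "i = Suc n") auto
qed

lemma is_form_var: "is_form 1 (Poly_Mapping.single (Poly_Mapping.single v 1) c)"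
  by (simp add: is_form_def)

text \<open>Interpolation between the powers of linear forms and the monomials of degree \<open>d\<close>. The induction
  step takes the coefficient of \<open>t\<close> in \<open>(x + t z)\<^sup>n m'\<close> for a variable \<open>z\<close> and \<open>n = d - j\<close>, which is
  \<open>n x\<^bsup>n-1\<^esup> z m'\<close>. The case \<open>j = d\<close> shows that every \<open>d\<close>-form has a Waring decomposition.\<close>

lemma power_times_monomial_in_span_powers:
  fixes x :: "'v cpoly"
  assumes "is_form 1 x" "monom_degree m = j" "j \<le> d"
  shows "x ^ (d - j) * Poly_Mapping.single m 1 \<in> cpoly.span {l ^ d | l. is_form 1 l}" (is "_ \<in> ?U")
  using assms
proof (induction j arbitrary: x m)
  case 0
  then have "m = 0"
    by (intro poly_mapping_eqI) (simp add: monom_degree_def in_keys_iff)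
  with 0 show ?case by (auto intro: cpoly.span_base)
next
  case (Suc j)
  obtain v m' where m: "m = Poly_Mapping.single v 1 + m'" "monom_degree m' = j"
    using Suc.prems(2) by (rule monom_degree_Suc_split)
  define z :: "'v cpoly" where "z = Poly_Mapping.single (Poly_Mapping.single v 1) 1"
  define n where "n = d - j"
  define f where "f = (\<lambda>i. cscale (of_nat (n choose i)) (z ^ i * x ^ (n - i) * Poly_Mapping.single m' 1))"
  have "(\<Sum>i\<le>n. cscale (t ^ i) (f i)) \<in> ?U" for t
  proof -
    have "is_form 1 (cscale t z + x)"
      by (intro is_form_add is_form_cscale Suc.prems) (simp only: z_def is_form_var)
    then have "(cscale t z + x) ^ (d - j) * Poly_Mapping.single m' 1 \<in> ?U"
      using Suc.prems m by (intro Suc.IH) auto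
    also have "(cscale t z + x) ^ (d - j) * Poly_Mapping.single m' 1 = (\<Sum>i\<le>n. cscale (t ^ i) (f i))"
      unfolding n_def[symmetric] binomial_ring sum_distrib_right f_def
      by (intro sum.cong refl)
        (simp only: of_nat_eq_cscale cscale_power cscale_times_left cpoly.scale_scale mult.commute[of "_ :: complex"])
    finally show ?thesis .
  qed
  moreover have "1 \<le> n" using Suc.prems by (simp add: n_def)
  ultimately have "f 1 \<in> ?U" by (rule coeffs_in_subspace[OF cpoly.subspace_span])
  then have "cscale (inverse (of_nat n)) (f 1) \<in> ?U" by (rule cpoly.span_scale)
  moreover have "cscale (inverse (of_nat n)) (f 1) = x ^ (d - Suc j) * Poly_Mapping.single m 1"
  proof -
    have "Poly_Mapping.single m 1 = z * Poly_Mapping.single m' 1"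
      by (simp add: m z_def mult_single)
    with \<open>1 \<le> n\<close> show ?thesis
      by (simp add: f_def n_def mult.commute mult.left_commute)
  qed
  ultimately show ?case by simp
qed

lemma form_in_span_powers:
  assumes "is_form d p"
  shows "p \<in> cpoly.span {l ^ d | l. is_form 1 l}"
proof -
  have "cscale (Poly_Mapping.lookup p m) (Poly_Mapping.single m 1) \<in> cpoly.span {l ^ d | l. is_form 1 l}"
    if "m \<in> Poly_Mapping.keys p" for m
    using power_times_monomial_in_span_powers[of 0 m d d] assms that
    by (intro cpoly.span_scale) (simp add: is_form_def)
  then have "(\<Sum>m\<in>Poly_Mapping.keys p. cscale (Poly_Mapping.lookup p m) (Poly_Mapping.single m 1)) \<in> cpoly.span {l ^ d | l. is_form 1 l}"
    by (rule cpoly.span_sum)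
  then show ?thesis by (simp add: poly_as_sum_of_monomials)
qed

text \<open>The Waring rank of a form of positive degree is attained: the set over which the least element is
  taken is nonempty.\<close>

lemma waring_sum_waring_rank:
  assumes "is_form d p" "d > 0"
  shows "waring_sum d (waring_rank d p) p"
proof -
  obtain T where "finite T" "T \<subseteq> {l ^ d | l. is_form 1 l}" "p \<in> cpoly.span T"
    using form_in_span_powers[OF assms(1)]
    unfolding cpoly.span_explicit[of "{l ^ d | l. is_form 1 l}"]
    by (blast intro: cpoly.span_sum cpoly.span_scale cpoly.span_base)
  then have "waring_sum d (card T) p" using \<open>d > 0\<close> by (rule waring_sum_span)
  then show ?thesis
    unfolding waring_rank_def waring_sum_def by (rule LeastI)
qed

section \<open>The lower bound for the Waring rank\<close>

lemma partial_deriv_span: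
  assumes "p \<in> cpoly.span S" "\<And>x. x \<in> S \<Longrightarrow> partial_deriv v x \<in> cpoly.span T"
  shows "partial_deriv v p \<in> cpoly.span T"
  using assms(1)
proof (induction rule: cpoly.span_induct_alt)
  case (step c x y)
  then show ?case
    by (simp add: partial_deriv_add partial_deriv_cscale assms(2) cpoly.span_add cpoly.span_scale)
qed (simp add: cpoly.span_zero)

lemma partial_deriv_linear_power:
  assumes "is_form 1 l"
  shows "\<exists>c. partial_deriv v (l ^ Suc n) = cscale c (l ^ n)"
proof -
  have "partial_deriv v l \<in> forms 0 UNIV"
    using partial_deriv_forms[of l 1 UNIV v] assms by simp
  then obtain c where c: "partial_deriv v l = Poly_Mapping.single 0 c"
    by (rule forms_0_const)
  show ?thesis
  proof (induction n)
    case 0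
    then show ?case using c by (auto simp: cscale_def)
  next
    case (Suc n)
    then obtain b where "partial_deriv v (l ^ Suc n) = cscale b (l ^ n)" by blast
    then have "partial_deriv v (l ^ Suc (Suc n)) = cscale c (l ^ Suc n) + cscale b (l ^ Suc n)"
      by (subst power_Suc) (simp add: partial_deriv_times c cscale_times_right cscale_def[of c])
    then show ?case by (metis cpoly.scale_left_distrib)
  qed
qed

lemma iterated_partial_deriv_span_powers:
  assumes "\<And>j. j \<in> J \<Longrightarrow> is_form 1 (l j)" "length vs \<le> d" "p \<in> cpoly.span ((\<lambda>j. l j ^ d) ` J)"
  shows "foldr partial_deriv vs p \<in> cpoly.span ((\<lambda>j. l j ^ (d - length vs)) ` J)"
  using assms(2)
proof (induction vs)
  case Nil
  then show ?case using assms(3) by simp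
next
  case (Cons v vs)
  then have "foldr partial_deriv vs p \<in> cpoly.span ((\<lambda>j. l j ^ (d - length vs)) ` J)"
    by simp
  then have "partial_deriv v (foldr partial_deriv vs p) \<in> cpoly.span ((\<lambda>j. l j ^ (d - length (v # vs))) ` J)"
  proof (rule partial_deriv_span)
    fix x assume "x \<in> (\<lambda>j. l j ^ (d - length vs)) ` J"
    moreover have "d - length vs = Suc (d - length (v # vs))"
      using Cons.prems by simp
    ultimately obtain j where j: "j \<in> J" "x = l j ^ Suc (d - length (v # vs))"
      by auto
    obtain c where "partial_deriv v x = cscale c (l j ^ (d - length (v # vs)))"
      unfolding j(2) using partial_deriv_linear_power[OF assms(1)[OF j(1)]] by blast
    then show "partial_deriv v x \<in> cpoly.span ((\<lambda>j. l j ^ (d - length (v # vs))) ` J)"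
      using j(1) by (simp only:) (intro cpoly.span_scale cpoly.span_base imageI)
  qed
  then show ?case by simp
qed

lemma Derivs_subset_span_powers:
  assumes "\<And>j. j \<in> J \<Longrightarrow> is_form 1 (l j)" "a \<le> d"
  shows "Derivs d (\<Sum>j\<in>J. l j ^ d) a \<subseteq> cpoly.span ((\<lambda>j. l j ^ a) ` J)"
  unfolding Derivs_def
proof (rule cpoly.span_minimal)
  have "(\<Sum>j\<in>J. l j ^ d) \<in> cpoly.span ((\<lambda>j. l j ^ d) ` J)"
    by (intro cpoly.span_sum cpoly.span_base) auto
  then have "foldr partial_deriv vs (\<Sum>j\<in>J. l j ^ d) \<in> cpoly.span ((\<lambda>j. l j ^ a) ` J)"
    if "length vs = d - a" for vs
    using iterated_partial_deriv_span_powers[of J l vs d "\<Sum>j\<in>J. l j ^ d"] assms that by simp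
  then show "{foldr partial_deriv vs (\<Sum>j\<in>J. l j ^ d) |vs. length vs = d - a} \<subseteq> cpoly.span ((\<lambda>j. l j ^ a) ` J)"
    by blast
qed simp

text \<open>An affine subspace of dimension \<open>w\<close> inside the span of \<open>n\<close> vectors contains a combination of at
  most \<open>n - w\<close> of them: extend a basis of the direction space \<open>V\<close> by some of the given vectors to a
  basis of the span, and remove from \<open>p\<close> its component in \<open>V\<close>.\<close>

lemma affine_subspace_meets_small_span:
  assumes V: "cpoly.subspace V" and G: "finite G" and W: "(\<lambda>q. p + q) ` V \<subseteq> cpoly.span G"
  obtains T q where "T \<subseteq> G" "card T + cpoly.dim V \<le> card G" "q \<in> (\<lambda>q. p + q) ` V" "q \<in> cpoly.span T"
proof -
  have "p + 0 \<in> cpoly.span G"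
    using W cpoly.subspace_0[OF V] by blast
  then have p: "p \<in> cpoly.span G" by simp
  have VG: "V \<subseteq> cpoly.span G"
  proof
    fix v assume "v \<in> V"
    then have "(p + v) - p \<in> cpoly.span G" using W p by (intro cpoly.span_diff) auto
    then show "v \<in> cpoly.span G" by simp
  qed
  obtain B where B: "B \<subseteq> V" "cpoly.independent B" "V \<subseteq> cpoly.span B" "card B = cpoly.dim V"
    by (rule cpoly.basis_exists)
  obtain C where C: "B \<subseteq> C" "C \<subseteq> B \<union> G" "cpoly.independent C" "B \<union> G \<subseteq> cpoly.span C"
    using cpoly.maximal_independent_subset_extend[OF Un_upper1 B(2)] by blast
  have "C \<subseteq> cpoly.span G" using C(2) B(1) VG cpoly.span_superset[of G] by auto
  from cpoly.independent_span_bound[OF G C(3) this] have cC: "finite C" "card C \<le> card G" by auto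
  \<comment> \<open>\<open>C\<close> is a basis of the span of \<open>G\<close> that extends the basis \<open>B\<close> of \<open>V\<close>.\<close>
  define T where "T = C - B"
  have "p \<in> cpoly.span C"
    using p C(4) cpoly.span_mono[of G "cpoly.span C"] by (auto simp: cpoly.span_span)
  also have "C = B \<union> T" using C(1) by (auto simp: T_def)
  finally obtain b t where bt: "b \<in> cpoly.span B" "t \<in> cpoly.span T" "p = b + t"
    by (auto simp: cpoly.span_Un)
  have "cpoly.span B \<subseteq> V" using B(1) V by (rule cpoly.span_minimal)
  with bt V have "- b \<in> V" using cpoly.subspace_neg by blast
  show thesis
  proof
    show "T \<subseteq> G" using C(2) by (auto simp: T_def)
    show "card T + cpoly.dim V \<le> card G"
      using cC C(1) B(4) card_mono[OF cC(1) C(1)] by (simp add: T_def card_Diff_subset finite_subset)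
    show "t \<in> (\<lambda>q. p + q) ` V" using \<open>- b \<in> V\<close> bt(3) by (intro image_eqI[of _ _ "- b"]) auto
  qed (rule bt(2))
qed

lemma minrank_le: "p \<in> W \<Longrightarrow> minrank a W \<le> waring_rank a p"
  unfolding minrank_def by (intro cInf_lower) auto

text \<open>In a decomposition of \<open>F\<close> into \<open>r\<close> powers \<open>l\<^sub>j\<^sup>d\<close>, all derivatives of degree \<open>a\<close> lie in the span of the
  powers \<open>l\<^sub>j\<^sup>a\<close>, so some element of \<open>W\<close> is a combination of at most \<open>r - dim W\<close> of these.\<close>

lemma waring_sum_lower_bound:
  assumes "waring_sum d r F" "affine_subspace W" "W \<subseteq> Derivs d F a" "0 < a" "a \<le> d"
  shows "affine_dim W + minrank a W \<le> r"
proof -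
  obtain l where l: "\<forall>j\<in>{1..r}. is_form 1 (l j)" "F = (\<Sum>j=1..r. l j ^ d)"
    using assms(1) by (auto simp: waring_sum_def)
  define G where "G = (\<lambda>j. l j ^ a) ` {1..r}"
  have G: "finite G" "card G \<le> r"
    using card_image_le[of "{1..r}" "\<lambda>j. l j ^ a"] by (auto simp: G_def)
  have "W \<subseteq> cpoly.span G"
    using assms(3,5) l Derivs_subset_span_powers[of "{1..r}" l a d] by (auto simp: G_def)
  moreover obtain p V where W: "cpoly.subspace V" "W = (\<lambda>q. p + q) ` V"
    using assms(2) by (auto simp: affine_subspace_def)
  ultimately obtain T q where T: "T \<subseteq> G" "card T + cpoly.dim V \<le> card G" "q \<in> W" "q \<in> cpoly.span T"
    using affine_subspace_meets_small_span[OF W(1) G(1), of p] by metis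
  have "waring_sum a (card T) q"
    using T G l(1) \<open>0 < a\<close> by (intro waring_sum_span) (auto simp: G_def intro: finite_subset)
  then have "minrank a W \<le> card T"
    using minrank_le[OF T(3)] waring_rank_le order_trans by blast
  moreover have "affine_dim W = cpoly.dim V"
    unfolding W(2) by (rule affine_dim_translate[OF W(1)])
  ultimately show ?thesis using T(2) G(2) by simp
qed

section \<open>Additivity of the rank of quadratic forms\<close>

text \<open>The products of two elements of \<open>S\<close>. When \<open>S\<close> consists of linear forms, the span of
  \<^term>\<open>products S\<close> consists of the quadratic forms in the elements of \<open>S\<close>.\<close>

definition products :: "'v cpoly set \<Rightarrow> 'v cpoly set" where
  "products S = {x * y | x y. x \<in> S \<and> y \<in> S}"

lemma times_in_span_products:
  assumes "x \<in> cpoly.span S" "y \<in> cpoly.span S"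
  shows "x * y \<in> cpoly.span (products S)"
  using assms(1)
proof (induction rule: cpoly.span_induct_alt)
  case (step c x x')
  have "x * y \<in> cpoly.span (products S)"
    using assms(2)
  proof (induction rule: cpoly.span_induct_alt)
    case (step c y y')
    with \<open>x \<in> S\<close> have "x * y \<in> products S" by (auto simp: products_def)
    with step show ?case
      by (simp add: ring_distribs cscale_times_right cpoly.span_add cpoly.span_scale cpoly.span_base)
  qed (simp add: cpoly.span_zero)
  with step show ?case
    by (simp add: ring_distribs cscale_times_left cpoly.span_add cpoly.span_scale)
qed (simp add: cpoly.span_zero)

lemma span_products_mono:
  assumes "S \<subseteq> cpoly.span T"
  shows "cpoly.span (products S) \<subseteq> cpoly.span (products T)"
proof (rule cpoly.span_minimal)
  show "products S \<subseteq> cpoly.span (products T)"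
    using assms times_in_span_products[of _ T] by (auto simp: products_def)
qed simp

lemma span_products_insert:
  assumes "q \<in> cpoly.span (products (insert e S))"
  obtains c m q' where "q = cscale c (e * e) + e * m + q'" "m \<in> cpoly.span S" "q' \<in> cpoly.span (products S)"
proof -
  have "\<exists>c m q'. q = cscale c (e * e) + e * m + q' \<and> m \<in> cpoly.span S \<and> q' \<in> cpoly.span (products S)"
    using assms
  proof (induction rule: cpoly.span_induct_alt)
    case base
    show ?case by (rule exI[of _ 0], rule exI[of _ 0], rule exI[of _ 0]) (simp add: cpoly.span_zero)
  next
    case (step k z q)
    then obtain c m q' where q: "q = cscale c (e * e) + e * m + q'" "m \<in> cpoly.span S" "q' \<in> cpoly.span (products S)"
      by blast
    obtain x y where z: "z = x * y" "x \<in> insert e S" "y \<in> insert e S"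
      using step.hyps by (auto simp: products_def)
    consider "x = e" "y = e" | w where "w \<in> S" "z = e * w" | "x \<in> S" "y \<in> S"
      using z by (auto simp: mult.commute)
    then show ?case
    proof cases
      case 1
      then have "cscale k z + q = cscale (k + c) (e * e) + e * m + q'"
        by (simp add: q z cpoly.scale_left_distrib)
      with q show ?thesis by blast
    next
      case 2
      then have "cscale k z + q = cscale c (e * e) + e * (cscale k w + m) + q'"
        by (simp add: q cscale_times_right ring_distribs)
      moreover have "cscale k w + m \<in> cpoly.span S"
        using q(2) 2(1) by (intro cpoly.span_add cpoly.span_scale) (auto intro: cpoly.span_base)
      ultimately show ?thesis using q by blast
    next
      case 3
      then have "z \<in> products S" using z by (auto simp: products_def)
      then have "cscale k z + q' \<in> cpoly.span (products S)"
        using q(3) by (intro cpoly.span_add cpoly.span_scale) (auto intro: cpoly.span_base)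
      moreover have "cscale k z + q = cscale c (e * e) + e * m + (cscale k z + q')"
        by (simp add: q)
      ultimately show ?thesis using q by blast
    qed
  qed
  with that show thesis by blast
qed

text \<open>\<open>S\<close> need not be independent, hence only some element of \<open>S\<close> can be exchanged for \<open>m\<close>.\<close>

lemma span_exchange:
  assumes "finite S" "m \<in> cpoly.span S" "m \<noteq> 0"
  shows "\<exists>s\<in>S. s \<in> cpoly.span (insert m (S - {s}))"
  using assms(1,2)
proof (induction S)
  case (insert s S)
  show ?case
  proof (cases "m \<in> cpoly.span S")
    case True
    with insert obtain t where t: "t \<in> S" "t \<in> cpoly.span (insert m (S - {t}))" by blast
    have "insert m (S - {t}) \<subseteq> insert m (insert s S - {t})" by auto
    with t show ?thesis using cpoly.span_mono by blast
  next
    case False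
    with insert have "s \<in> cpoly.span (insert m S)"
      using cpoly.in_span_insert by blast
    with insert show ?thesis by auto
  qed
qed (use assms(3) in simp)

text \<open>This is \<open>4 x y = (x + y)\<^sup>2 - (x - y)\<^sup>2\<close>; over the complex numbers the minus sign is absorbed into
  the square.\<close>

lemma waring_sum_product:
  assumes "is_form 1 x" "is_form 1 y"
  shows "waring_sum 2 2 (x * y)"
proof -
  have y': "is_form 1 (x - y)"
    using cpoly.subspace_diff[OF subspace_forms[of 1 UNIV]] assms by simp
  have "waring_sum 2 (1 + 1) (cscale (1/4) ((x + y) ^ 2) + cscale (- (1/4)) ((x - y) ^ 2))"
    using assms y' by (intro waring_sum_add waring_sum_cscale_power is_form_add) auto
  also have "cscale (1/4) ((x + y) ^ 2) + cscale (- (1/4)) ((x - y) ^ 2) =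
      cscale (1/4) ((x + y) ^ 2 - (x - y) ^ 2)"
    by (simp add: cpoly.scale_right_diff_distrib)
  also have "(x + y) ^ 2 - (x - y) ^ 2 = of_nat 4 * (x * y)"
    by (simp add: power2_eq_square algebra_simps)
  also have "cscale (1/4) (of_nat 4 * (x * y)) = x * y"
    unfolding of_nat_eq_cscale by simp
  finally show ?thesis by (simp add: numeral_2_eq_2)
qed

lemma complete_square:
  fixes e m :: "'v cpoly"
  assumes "c \<noteq> 0"
  shows "cscale c (e * e) + e * m = cscale c ((e + cscale (1 / (2 * c)) m) ^ 2) - cscale (1 / (4 * c)) (m * m)"
proof -
  have "(e + cscale (1 / (2 * c)) m) ^ 2 = e * e + (cscale (1 / (2 * c)) (e * m) + cscale (1 / (2 * c)) (e * m))
     + cscale (1 / (4 * c * c)) (m * m)"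
    by (simp add: power2_eq_square ring_distribs cscale_times_left cscale_times_right mult.commute[of m e] mult_ac add_ac)
  also have "cscale (1 / (2 * c)) (e * m) + cscale (1 / (2 * c)) (e * m) = cscale (1 / c) (e * m)"
    using assms by (simp flip: cpoly.scale_left_distrib)
  finally have "(e + cscale (1 / (2 * c)) m) ^ 2 = e * e + cscale (1 / c) (e * m) + cscale (1 / (4 * c * c)) (m * m)" .
  then show ?thesis using assms by (simp add: cpoly.scale_right_distrib)
qed

text \<open>Diagonalization: a quadratic form in \<open>n\<close> linear forms is a sum of \<open>n\<close> squares of linear forms.
  Single out \<open>e\<close> and write the form as \<open>c e\<^sup>2 + e m + q'\<close>. If \<open>c \<noteq> 0\<close>, completing the square removes
  \<open>e\<close>. If \<open>c = 0\<close> and \<open>m \<noteq> 0\<close>, then \<open>m\<close> replaces one of the other linear forms, and all the terms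
  divisible by \<open>m\<close> combine to a product of two linear forms, that is, to two squares.\<close>

lemma waring_sum_quadratic:
  assumes "finite S" "\<And>x. x \<in> S \<Longrightarrow> is_form 1 x" "q \<in> cpoly.span (products S)"
  shows "waring_sum 2 (card S) q"
  using assms
proof (induction "card S" arbitrary: S q rule: less_induct)
  case less
  have lin: "is_form 1 x" if "x \<in> cpoly.span U" "U \<subseteq> S" for x U
    using cpoly.span_minimal[OF _ subspace_forms[of 1 UNIV], of U] that less.prems(2) by auto
  show ?case
  proof (cases "S = {}")
    case True
    with less.prems(3) show ?thesis by (simp add: products_def waring_sum_0)
  next
    case False
    then obtain e S' where S: "S = insert e S'" "e \<notin> S'" by (meson mk_disjoint_insert ex_in_conv)
    then have S': "finite S'" "card S = Suc (card S')" "S' \<subseteq> S" using less.prems(1) by auto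
    have e: "is_form 1 e" using less.prems(2) S by simp
    obtain c m q' where q: "q = cscale c (e * e) + e * m + q'" "m \<in> cpoly.span S'" "q' \<in> cpoly.span (products S')"
      using less.prems(3) unfolding S(1) by (rule span_products_insert)
    have m: "is_form 1 m" using q(2) S'(3) by (rule lin)
    show ?thesis
    proof (cases "c = 0")
      case False
      define r where "r = q' - cscale (1 / (4 * c)) (m * m)"
      have "r \<in> cpoly.span (products S')"
        unfolding r_def using q by (intro cpoly.span_diff cpoly.span_scale times_in_span_products)
      then have "waring_sum 2 (card S') r"
        using S' less.prems(2) by (intro less.hyps) auto
      then have "waring_sum 2 (1 + card S') (cscale c ((e + cscale (1 / (2 * c)) m) ^ 2) + r)"
        using e m by (intro waring_sum_add waring_sum_cscale_power is_form_add is_form_cscale) auto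
      moreover have "q = cscale c ((e + cscale (1 / (2 * c)) m) ^ 2) + r"
        unfolding q(1) complete_square[OF False] r_def by simp
      ultimately show ?thesis using S' by simp
    next
      case c: True
      show ?thesis
      proof (cases "m = 0")
        case True
        have "waring_sum 2 (card S') q'"
          using S' q less.prems(2) by (intro less.hyps) auto
        with True c show ?thesis using S' q by (auto intro: waring_sum_mono)
      next
        case False
        \<comment> \<open>Here \<open>q = e m + q'\<close>; rewrite \<open>q'\<close> in terms of \<open>m\<close> and \<open>T = S' - {s}\<close>.\<close>
        then obtain s where s: "s \<in> S'" "s \<in> cpoly.span (insert m (S' - {s}))"
          using span_exchange[OF S'(1) q(2)] by blast
        define T where "T = S' - {s}"
        have T: "finite T" "card S' = Suc (card T)" "T \<subseteq> S"
          using S' s by (auto simp: T_def) (metis Suc_pred card_gt_0_iff empty_iff)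
        have "S' \<subseteq> cpoly.span (insert m T)"
          using s by (auto simp: T_def intro: cpoly.span_base)
        with q(3) have "q' \<in> cpoly.span (products (insert m T))"
          using span_products_mono by blast
        then obtain c' n q'' where q': "q' = cscale c' (m * m) + m * n + q''" "n \<in> cpoly.span T" "q'' \<in> cpoly.span (products T)"
          by (rule span_products_insert)
        have n: "is_form 1 n" using q'(2) T(3) by (rule lin)
        have "waring_sum 2 (card T) q''"
          using S' T q' less.prems(2) by (intro less.hyps) auto
        then have "waring_sum 2 (2 + card T) (m * (e + cscale c' m + n) + q'')"
          using e m n by (intro waring_sum_add waring_sum_product is_form_add is_form_cscale)
        moreover have "q = m * (e + cscale c' m + n) + q''"
          using c by (simp add: q(1) q'(1) ring_distribs cscale_times_right mult.commute)
        ultimately show ?thesis using S' T by simp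
      qed
    qed
  qed
qed

text \<open>Linear independence over the linear forms in the other variables: differentiating the relation by
  \<open>u \<in> A\<close> leaves a scalar relation between the independent linear forms \<open>b i\<close>.\<close>

lemma linear_tensor_zero:
  fixes f b :: "nat \<Rightarrow> 'v cpoly"
  assumes "finite T" "inj_on b T" "cpoly.independent (b ` T)"
    and "\<And>i. i \<in> T \<Longrightarrow> f i \<in> forms 1 A" "\<And>i. i \<in> T \<Longrightarrow> b i \<in> forms 1 (- A)"
    and "(\<Sum>i\<in>T. f i * b i) = 0" "i \<in> T"
  shows "f i = 0"
proof (rule partial_deriv_all_zero[of _ 0 A])
  show "f i \<in> forms (Suc 0) A" using assms(4,7) by simp
next
  fix u assume u: "u \<in> A"
  have "\<exists>c. partial_deriv u (f i) = Poly_Mapping.single 0 c" if "i \<in> T" for i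
  proof -
    have "partial_deriv u (f i) \<in> forms 0 A"
      using partial_deriv_forms[OF assms(4)[OF that], of u] by simp
    then show ?thesis using forms_0_const by blast
  qed
  then obtain c where c: "\<And>i. i \<in> T \<Longrightarrow> partial_deriv u (f i) = Poly_Mapping.single 0 (c i)"
    by metis
  have "partial_deriv u (f i * b i) = cscale (c i) (b i)" if "i \<in> T" for i
  proof -
    have "partial_deriv u (b i) = 0"
      using u by (intro partial_deriv_other_var[OF assms(5)[OF that]]) simp
    then show ?thesis by (simp add: partial_deriv_times c[OF that] cscale_def)
  qed
  then have "(\<Sum>i\<in>T. cscale (c i) (b i)) = partial_deriv u (\<Sum>i\<in>T. f i * b i)"
    by (simp add: partial_deriv_sum)
  also have "\<dots> = 0" by (simp add: assms(6))
  also have "(\<Sum>i\<in>T. cscale (c i) (b i)) = (\<Sum>x\<in>b ` T. cscale (c (the_inv_into T b x)) x)"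
    by (simp add: sum.reindex[OF assms(2)] the_inv_into_f_f[OF assms(2)])
  finally have "c (the_inv_into T b (b i)) = 0"
    using cpoly.independentD[OF assms(3) finite_imageI[OF assms(1)] subset_refl, of "\<lambda>x. c (the_inv_into T b x)" "b i"]
      assms(7) by simp
  then show "partial_deriv u (f i) = 0"
    using c[OF assms(7)] assms(7) by (simp add: the_inv_into_f_f[OF assms(2)])
qed

text \<open>The key step for the additivity of the rank of quadratic forms. Split the linear forms of the
  decomposition as \<open>l\<^sub>j = a\<^sub>j + b\<^sub>j\<close> with \<open>a\<^sub>j\<close> in the variables from \<open>A\<close> and \<open>b\<^sub>j\<close> in the others. Setting
  variables to zero gives \<open>p = \<Sum>\<^sub>j a\<^sub>j\<^sup>2\<close> and \<open>q = \<Sum>\<^sub>j b\<^sub>j\<^sup>2\<close>, hence \<open>\<Sum>\<^sub>j a\<^sub>j b\<^sub>j = 0\<close>. Choose a basis of the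
  span of the \<open>b\<^sub>j\<close> among them, with index set \<open>T\<close>. Expressing every \<open>b\<^sub>j\<close> in this basis turns the
  relation into equations that express \<open>a\<^sub>i\<close>, for \<open>i \<in> T\<close>, by the \<open>a\<^sub>j\<close> with \<open>j \<notin> T\<close>. So \<open>q\<close> is a
  quadratic form in \<open>card T\<close> linear forms, and \<open>p\<close> in the remaining number \<open>r - card T\<close>.\<close>

lemma waring_sum_quadratic_split:
  assumes pA: "p \<in> forms 2 A" and qA: "q \<in> forms 2 (- A)" and "waring_sum 2 r (p + q)"
  obtains s t where "s + t = r" "waring_sum 2 s p" "waring_sum 2 t q"
proof -
  obtain l where l: "\<forall>j\<in>{1..r}. is_form 1 (l j)" "p + q = (\<Sum>j=1..r. l j ^ 2)"
    using assms(3) by (auto simp: waring_sum_def)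
  define a b where "a = (\<lambda>j. restrict_vars A (l j))" and "b = (\<lambda>j. restrict_vars (- A) (l j))"
  define J where "J = {1..r}"
  have lf: "a j \<in> forms 1 A" "b j \<in> forms 1 (- A)" "l j = a j + b j" if "j \<in> J" for j
    using l(1) that linear_form_split_vars[of "l j" A] by (auto simp: a_def b_def J_def intro: restrict_vars_forms)
  have p: "p = (\<Sum>j\<in>J. a j * a j)"
    using arg_cong[OF l(2), of "restrict_vars A"] restrict_vars_same[OF pA] restrict_vars_disjoint[OF qA, of A]
    by (simp add: restrict_vars_add restrict_vars_sum restrict_vars_times power2_eq_square a_def J_def)
  have q: "q = (\<Sum>j\<in>J. b j * b j)"
    using arg_cong[OF l(2), of "restrict_vars (- A)"] restrict_vars_same[OF qA] restrict_vars_disjoint[OF pA, of "- A"]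
    by (simp add: restrict_vars_add restrict_vars_sum restrict_vars_times power2_eq_square b_def J_def)
  have "p + q = (\<Sum>j\<in>J. (a j + b j) ^ 2)"
    unfolding l(2) J_def[symmetric] using lf(3) by simp
  also have "\<dots> = p + q + of_nat 2 * (\<Sum>j\<in>J. a j * b j)"
    by (simp add: p q power2_eq_square algebra_simps sum.distrib sum_distrib_left mult_2)
  finally have "cscale 2 (\<Sum>j\<in>J. a j * b j) = 0"
    by (simp only: of_nat_eq_cscale) simp
  then have ab: "(\<Sum>j\<in>J. a j * b j) = 0" by simp

  obtain T where T: "T \<subseteq> J" "inj_on b T" "cpoly.independent (b ` T)" "b ` J \<subseteq> cpoly.span (b ` T)"
    by (metis cpoly.maximal_independent_subset subset_image_inj)
  have finT: "finite T" using T(1) by (rule finite_subset) (simp add: J_def)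
  have "\<forall>j\<in>J. \<exists>u. b j = (\<Sum>i\<in>T. cscale (u i) (b i))"
  proof
    fix j assume "j \<in> J"
    then have "b j \<in> cpoly.span (b ` T)" using T(4) by auto
    then obtain u where "b j = (\<Sum>x\<in>b ` T. cscale (u x) x)"
      by (auto simp: cpoly.span_finite[OF finite_imageI[OF finT]])
    then have "b j = (\<Sum>i\<in>T. cscale (u (b i)) (b i))"
      by (simp add: sum.reindex[OF T(2)])
    then show "\<exists>u. b j = (\<Sum>i\<in>T. cscale (u i) (b i))" by (rule exI[of _ "\<lambda>i. u (b i)"])
  qed
  then obtain u where u: "\<And>j. j \<in> J \<Longrightarrow> b j = (\<Sum>i\<in>T. cscale (u j i) (b i))" by metis
  \<comment> \<open>\<open>f i\<close> is the coefficient of \<open>b i\<close> once all \<open>b j\<close> are expressed in the basis.\<close>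
  define f where "f = (\<lambda>i. a i + (\<Sum>j\<in>J - T. cscale (u j i) (a j)))"
  have f0: "f i = 0" if "i \<in> T" for i
  proof (rule linear_tensor_zero[OF finT T(2,3) _ _ _ that])
    show "f i \<in> forms 1 A" if "i \<in> T" for i
      unfolding f_def using that T(1) lf(1)
      by (intro cpoly.subspace_add cpoly.subspace_sum cpoly.subspace_scale subspace_forms) auto
    show "b i \<in> forms 1 (- A)" if "i \<in> T" for i using that T(1) lf(2) by auto
    have "(\<Sum>i\<in>T. f i * b i) = (\<Sum>i\<in>T. a i * b i) + (\<Sum>i\<in>T. \<Sum>j\<in>J - T. a j * cscale (u j i) (b i))"
      by (simp add: f_def ring_distribs sum.distrib sum_distrib_right cscale_times_left cscale_times_right)
    also have "(\<Sum>i\<in>T. \<Sum>j\<in>J - T. a j * cscale (u j i) (b i)) = (\<Sum>j\<in>J - T. a j * b j)"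
      by (subst sum.swap) (intro sum.cong refl, simp add: u sum_distrib_left)
    also have "(\<Sum>i\<in>T. a i * b i) + (\<Sum>j\<in>J - T. a j * b j) = (\<Sum>j\<in>J. a j * b j)"
      using sum.subset_diff[OF T(1), of "\<lambda>j. a j * b j"] by (simp add: J_def add.commute)
    finally show "(\<Sum>i\<in>T. f i * b i) = 0" using ab by simp
  qed
  have a_span: "a j \<in> cpoly.span (a ` (J - T))" if "j \<in> J" for j
  proof (cases "j \<in> T")
    case True
    have "a j = - (\<Sum>k\<in>J - T. cscale (u k j) (a k))"
      using f0[OF True] by (simp add: f_def add_eq_0_iff)
    also have "\<dots> \<in> cpoly.span (a ` (J - T))"
      by (intro cpoly.span_neg cpoly.span_sum cpoly.span_scale cpoly.span_base imageI)
    finally show ?thesis .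
  qed (use that in \<open>auto intro: cpoly.span_base\<close>)
  have "p \<in> cpoly.span (products (a ` (J - T)))"
    unfolding p by (intro cpoly.span_sum times_in_span_products a_span)
  then have "waring_sum 2 (card (a ` (J - T))) p"
    using lf(1) by (intro waring_sum_quadratic) (auto simp: J_def forms_def)
  then have ws: "waring_sum 2 (card (J - T)) p"
    by (rule waring_sum_mono) (auto simp: J_def intro: card_image_le)
  have "q \<in> cpoly.span (products (b ` T))"
    unfolding q using T(4) by (intro cpoly.span_sum times_in_span_products) auto
  then have "waring_sum 2 (card (b ` T)) q"
    using lf(2) T(1) finT by (intro waring_sum_quadratic) (auto simp: forms_def)
  then have wt: "waring_sum 2 (card T) q"
    by (simp add: card_image[OF T(2)])
  have "card (J - T) + card T = r"
    using card_Diff_subset[OF finT T(1)] card_mono[OF _ T(1)] by (simp add: J_def)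
  then show thesis using ws wt by (rule that)
qed

section \<open>Spaces of derivatives of a sum in independent variables\<close>

lemma iterated_partial_deriv_forms:
  "p \<in> forms d A \<Longrightarrow> foldr partial_deriv vs p \<in> forms (d - length vs) A"
proof (induction vs)
  case (Cons v vs)
  then show ?case using partial_deriv_forms[of "foldr partial_deriv vs p" "d - length vs" A v] by simp
qed simp

lemma iterated_partial_deriv_add:
  "foldr partial_deriv vs (p + q) = foldr partial_deriv vs p + foldr partial_deriv vs q"
  by (induction vs) (simp_all add: partial_deriv_add)

lemma iterated_partial_deriv_other_var:
  assumes "p \<in> forms d A" "v \<in> set vs" "v \<notin> A"
  shows "foldr partial_deriv vs p = 0"
  using assms(2)
proof (induction vs)
  case (Cons w vs)
  show ?case
  proof (cases "v \<in> set vs")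
    case False
    then show ?thesis
      using Cons.prems partial_deriv_other_var[OF iterated_partial_deriv_forms[OF assms(1)] assms(3), of vs] by simp
  qed (use Cons.IH in simp)
qed simp

lemma exists_nonzero_iterated_partial_deriv:
  assumes "p \<in> forms d A" "p \<noteq> 0" "n \<le> d"
  shows "\<exists>vs. length vs = n \<and> foldr partial_deriv vs p \<noteq> 0"
  using assms(3)
proof (induction n)
  case (Suc n)
  then obtain vs where vs: "length vs = n" "foldr partial_deriv vs p \<noteq> 0" by auto
  have "foldr partial_deriv vs p \<in> forms (Suc (d - Suc n)) A"
    using iterated_partial_deriv_forms[OF assms(1), of vs] vs(1) Suc.prems by (simp add: Suc_diff_Suc)
  then obtain v where "partial_deriv v (foldr partial_deriv vs p) \<noteq> 0"
    using partial_deriv_all_zero vs(2) by blast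
  with vs show ?case by (intro exI[of _ "v # vs"]) simp
qed (use assms in auto)

lemma Derivs_subset_forms:
  assumes "p \<in> forms d A" "a \<le> d"
  shows "Derivs d p a \<subseteq> forms a A"
  unfolding Derivs_def
proof (rule cpoly.span_minimal[OF _ subspace_forms], safe)
  fix vs :: "'a list" assume "length vs = d - a"
  with iterated_partial_deriv_forms[OF assms(1), of vs] \<open>a \<le> d\<close>
  show "foldr partial_deriv vs p \<in> forms a A" by simp
qed

text \<open>The hypothesis \<open>a < d\<close> is essential: at least one derivative is needed to kill the other
  summand. For \<open>a = 2\<close> it is the assumption \<open>d \<ge> 3\<close> of the theorem.\<close>

lemma Derivs_subset_Derivs_add:
  assumes p: "p \<in> forms d A" and q: "q \<in> forms d B" and "A \<inter> B = {}" "a < d"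
  shows "Derivs d p a \<subseteq> Derivs d (p + q) a"
  unfolding Derivs_def
proof (rule cpoly.span_minimal, safe)
  fix vs :: "'a list" assume vs: "length vs = d - a"
  show "foldr partial_deriv vs p \<in> cpoly.span {foldr partial_deriv vs (p + q) |vs. length vs = d - a}"
  proof (cases "set vs \<subseteq> A")
    case True
    obtain v where "v \<in> set vs" using vs \<open>a < d\<close> by (cases vs) auto
    with True assms(3) have "foldr partial_deriv vs q = 0"
      by (intro iterated_partial_deriv_other_var[OF q]) auto
    then have "foldr partial_deriv vs p = foldr partial_deriv vs (p + q)"
      by (simp add: iterated_partial_deriv_add)
    then show ?thesis using vs by (intro cpoly.span_base) auto
  next
    case False
    then have "foldr partial_deriv vs p = 0"
      using iterated_partial_deriv_other_var[OF p] by blast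
    then show ?thesis by (simp add: cpoly.span_zero)
  qed
qed

lemma Derivs_finite_dim:
  assumes "is_form d p" "0 < d" "a \<le> d"
  obtains G where "finite G" "Derivs d p a \<subseteq> cpoly.span G"
proof -
  obtain l where l: "\<forall>j\<in>{1..waring_rank d p}. is_form 1 (l j)" "p = (\<Sum>j=1..waring_rank d p. l j ^ d)"
    using waring_sum_waring_rank[OF assms(1,2)] by (auto simp: waring_sum_def)
  then have "Derivs d p a \<subseteq> cpoly.span ((\<lambda>j. l j ^ a) ` {1..waring_rank d p})"
    using Derivs_subset_span_powers[of "{1..waring_rank d p}" l a d] assms(3) by simp
  then show thesis by (rule that[rotated]) simp
qed

text \<open>The bounds by finite sets cannot be dropped, as the dimension of an infinite-dimensional space is
  \<open>0\<close> by convention.\<close>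

lemma dim_direct_sum:
  assumes V: "cpoly.subspace V" "finite G" "V \<subseteq> cpoly.span G"
    and U: "cpoly.subspace U" "finite H" "U \<subseteq> cpoly.span H" and VU: "V \<inter> U \<subseteq> {0}"
  shows "cpoly.dim {x + y | x y. x \<in> V \<and> y \<in> U} = cpoly.dim V + cpoly.dim U"
proof -
  obtain B where B: "B \<subseteq> V" "cpoly.independent B" "V \<subseteq> cpoly.span B" "card B = cpoly.dim V"
    by (rule cpoly.basis_exists)
  obtain C where C: "C \<subseteq> U" "cpoly.independent C" "U \<subseteq> cpoly.span C" "card C = cpoly.dim U"
    by (rule cpoly.basis_exists)
  have fin: "finite B" "finite C"
    using cpoly.independent_span_bound[OF V(2) B(2)] cpoly.independent_span_bound[OF U(2) C(2)] B(1) C(1) V(3) U(3)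
    by auto
  have sB: "cpoly.span B = V" and sC: "cpoly.span C = U"
    using B C V(1) U(1) cpoly.span_minimal by blast+
  have "0 \<notin> B" using B(2) cpoly.dependent_zero by blast
  then have disj: "B \<inter> C = {}" using B(1) C(1) VU by auto
  have "cpoly.independent (B \<union> C)"
  proof (rule cpoly.independent_if_scalars_zero)
    fix f x assume s: "(\<Sum>x\<in>B \<union> C. cscale (f x) x) = 0" and x: "x \<in> B \<union> C"
    define b c where "b = (\<Sum>x\<in>B. cscale (f x) x)" and "c = (\<Sum>x\<in>C. cscale (f x) x)"
    have bc: "b + c = 0"
      using s fin disj by (simp add: b_def c_def sum.union_disjoint)
    have "b \<in> V" unfolding b_def
      using B(1) V(1) by (auto intro: cpoly.subspace_sum cpoly.subspace_scale)
    moreover have "c \<in> U" unfolding c_def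
      using C(1) U(1) by (auto intro: cpoly.subspace_sum cpoly.subspace_scale)
    then have "- c \<in> U" using U(1) by (rule cpoly.subspace_neg[rotated])
    ultimately have "b = 0" using bc VU by (auto simp: eq_neg_iff_add_eq_0[symmetric])
    with bc have "c = 0" by simp
    show "f x = 0"
      using x cpoly.independentD[OF B(2) fin(1) subset_refl, of f x]
        cpoly.independentD[OF C(2) fin(2) subset_refl, of f x] \<open>b = 0\<close> \<open>c = 0\<close>
      by (auto simp: b_def c_def)
  qed (use fin in simp)
  moreover have "{x + y | x y. x \<in> V \<and> y \<in> U} = cpoly.span (B \<union> C)"
    by (simp add: cpoly.span_Un sB sC)
  ultimately have "cpoly.dim {x + y | x y. x \<in> V \<and> y \<in> U} = card (B \<union> C)"
    by (simp add: cpoly.dim_eq_card_independent)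
  with B(4) C(4) fin disj show ?thesis by (simp add: card_Un_disjoint)
qed

section \<open>Sharp lower bounds and additivity\<close>

text \<open>The lower bounds for the Waring rank of a \<open>d\<close>-form that come from the nonlinear affine subspaces
  of its space of derivatives of degree 2.\<close>

definition derivs_bounds :: "nat \<Rightarrow> 'v cpoly \<Rightarrow> nat set" where
  "derivs_bounds d p = {affine_dim W + minrank 2 W | W.
     affine_subspace W \<and> 0 \<notin> W \<and> W \<subseteq> Derivs d p 2}"

lemma derivs_bounds_le_waring_rank:
  assumes "is_form d p" "2 \<le> d" "b \<in> derivs_bounds d p"
  shows "b \<le> waring_rank d p"
proof -
  obtain W where W: "b = affine_dim W + minrank 2 W" "affine_subspace W" "W \<subseteq> Derivs d p 2"
    using assms(3) unfolding derivs_bounds_def by blast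
  have "waring_sum d (waring_rank d p) p"
    using assms by (intro waring_sum_waring_rank) auto
  then show ?thesis
    unfolding W(1) using W(2,3) assms(2) by (intro waring_sum_lower_bound[of d _ p]) auto
qed

lemma finite_derivs_bounds:
  assumes "is_form d p" "2 \<le> d"
  shows "finite (derivs_bounds d p)"
proof (rule finite_subset)
  show "derivs_bounds d p \<subseteq> {..waring_rank d p}"
    using derivs_bounds_le_waring_rank[OF assms] by blast
qed simp

text \<open>A nonzero derivative of degree 2 is a zero-dimensional nonlinear affine subspace.\<close>

lemma derivs_bounds_nonempty:
  assumes "is_form d p" "2 \<le> d" "p \<noteq> 0"
  shows "derivs_bounds d p \<noteq> {}"
proof -
  obtain vs where vs: "length vs = d - 2" "foldr partial_deriv vs p \<noteq> 0"
    using exists_nonzero_iterated_partial_deriv[of p d UNIV "d - 2"] assms by auto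
  let ?W = "{foldr partial_deriv vs p}"
  have "affine_subspace ?W"
    unfolding affine_subspace_def by (rule exI[of _ "foldr partial_deriv vs p"], rule exI[of _ "{0}"]) simp
  moreover have "?W \<subseteq> Derivs d p 2"
    using vs(1) by (auto simp: Derivs_def intro: cpoly.span_base)
  moreover have "0 \<notin> ?W"
    using vs(2) by simp
  ultimately show ?thesis
    unfolding derivs_bounds_def by blast
qed

lemma waring_rank_add_le:
  assumes "is_form d p" "is_form d q" "0 < d"
  shows "waring_rank d (p + q) \<le> waring_rank d p + waring_rank d q"
  using assms by (intro waring_rank_le waring_sum_add waring_sum_waring_rank)

lemma waring_rank_quadratic_add:
  assumes p: "p \<in> forms 2 A" and q: "q \<in> forms 2 B" and "A \<inter> B = {}"
  shows "waring_rank 2 (p + q) = waring_rank 2 p + waring_rank 2 q"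
proof (rule antisym)
  have pq: "is_form 2 p" "is_form 2 q" using p q by (auto simp: forms_def)
  then show "waring_rank 2 (p + q) \<le> waring_rank 2 p + waring_rank 2 q"
    by (intro waring_rank_add_le) auto
  have "q \<in> forms 2 (- A)" using q assms(3) forms_mono[of B "- A"] by blast
  from waring_sum_quadratic_split[OF p this waring_sum_waring_rank[OF is_form_add[OF pq]]]
  obtain s t where "s + t = waring_rank 2 (p + q)" "waring_sum 2 s p" "waring_sum 2 t q" by auto
  then show "waring_rank 2 p + waring_rank 2 q \<le> waring_rank 2 (p + q)"
    by (metis add_mono waring_rank_le)
qed

lemma minrank_attained:
  assumes "W \<noteq> {}"
  obtains p where "p \<in> W" "waring_rank a p = minrank a W"
proof -
  have "minrank a W \<in> waring_rank a ` W"
    unfolding minrank_def using assms by (intro Inf_nat_def1) simp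
  with that show thesis by auto
qed

text \<open>If \<open>W1\<close> and \<open>W2\<close> give the bounds \<open>b\<close> and \<open>c\<close>, then \<open>W1 + W2\<close> gives a bound of at least \<open>b + c\<close>.\<close>

lemma derivs_bounds_add:
  assumes F: "F \<in> forms d A" and G: "G \<in> forms d B" and AB: "A \<inter> B = {}" and d: "3 \<le> d"
    and b: "b \<in> derivs_bounds d F" and c: "c \<in> derivs_bounds d G"
  shows "\<exists>e\<in>derivs_bounds d (F + G). b + c \<le> e"
proof -
  obtain W1 p1 V1 where W1: "b = affine_dim W1 + minrank 2 W1" "0 \<notin> W1" "W1 \<subseteq> Derivs d F 2"
    "cpoly.subspace V1" "W1 = (\<lambda>q. p1 + q) ` V1"
    using b unfolding derivs_bounds_def affine_subspace_def by blast
  obtain W2 p2 V2 where W2: "c = affine_dim W2 + minrank 2 W2" "0 \<notin> W2" "W2 \<subseteq> Derivs d G 2"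
    "cpoly.subspace V2" "W2 = (\<lambda>q. p2 + q) ` V2"
    using c unfolding derivs_bounds_def affine_subspace_def by blast
  define V where "V = {x + y | x y. x \<in> V1 \<and> y \<in> V2}"
  define W where "W = (\<lambda>q. (p1 + p2) + q) ` V"
  have V: "cpoly.subspace V" unfolding V_def using W1(4) W2(4) by (rule cpoly.subspace_sums)
  have W_elem: "\<exists>x\<in>W1. \<exists>y\<in>W2. w = x + y" if w: "w \<in> W" for w
  proof -
    obtain x y where xy: "x \<in> V1" "y \<in> V2" "w = p1 + p2 + (x + y)"
      using w by (auto simp: W_def V_def)
    have "w = (p1 + x) + (p2 + y)"
      unfolding xy(3) by (simp only: add_ac)
    moreover have "p1 + x \<in> W1"
      unfolding W1(5) using xy(1) by (rule imageI)
    moreover have "p2 + y \<in> W2"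
      unfolding W2(5) using xy(2) by (rule imageI)
    ultimately show ?thesis by blast
  qed
  have FG: "is_form d F" "is_form d G"
    using F G by (simp_all add: forms_def)
  have DF: "Derivs d F 2 \<subseteq> forms 2 A" and DG: "Derivs d G 2 \<subseteq> forms 2 B"
    using Derivs_subset_forms[OF F, of 2] Derivs_subset_forms[OF G, of 2] d by simp_all
  \<comment> \<open>The direction spaces consist of differences of elements of \<open>W1\<close> and of \<open>W2\<close>.\<close>
  have dir: "V1 \<subseteq> Derivs d F 2" "V2 \<subseteq> Derivs d G 2"
  proof -
    have *: "V \<subseteq> U" if "cpoly.subspace V" "cpoly.subspace U" "(\<lambda>q. p + q) ` V \<subseteq> U" for p :: "'a cpoly" and V U
    proof
      fix v assume "v \<in> V"
      moreover have "0 \<in> V" using that(1) by (rule cpoly.subspace_0)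
      ultimately have "p + v \<in> U" "p + 0 \<in> U"
        using that(3) by blast+
      then have "(p + v) - (p + 0) \<in> U"
        by (rule cpoly.subspace_diff[OF that(2)])
      then show "v \<in> U" by simp
    qed
    have sub: "cpoly.subspace (Derivs d p 2)" for p :: "'a cpoly"
      unfolding Derivs_def by (rule cpoly.subspace_span)
    show "V1 \<subseteq> Derivs d F 2"
      using W1(3) unfolding W1(5) by (rule *[OF W1(4) sub])
    show "V2 \<subseteq> Derivs d G 2"
      using W2(3) unfolding W2(5) by (rule *[OF W2(4) sub])
  qed
  have "affine_dim W = cpoly.dim V1 + cpoly.dim V2"
  proof -
    have d': "0 < d" "2 \<le> d" using d by auto
    obtain S where S: "finite S" "Derivs d F 2 \<subseteq> cpoly.span S"
      using Derivs_finite_dim[OF FG(1) d'] by blast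
    obtain T where T: "finite T" "Derivs d G 2 \<subseteq> cpoly.span T"
      using Derivs_finite_dim[OF FG(2) d'] by blast
    have "x = 0" if "x \<in> V1" "x \<in> V2" for x
    proof (rule forms_disjoint[OF _ _ AB, of _ 2])
      show "x \<in> forms 2 A" using that(1) dir(1) DF by blast
      show "x \<in> forms 2 B" using that(2) dir(2) DG by blast
    qed simp
    then have "V1 \<inter> V2 \<subseteq> {0}" by blast
    then have "cpoly.dim V = cpoly.dim V1 + cpoly.dim V2"
      unfolding V_def
      by (rule dim_direct_sum[OF W1(4) S(1) order_trans[OF dir(1) S(2)] W2(4) T(1) order_trans[OF dir(2) T(2)]])
    then show ?thesis unfolding W_def by (simp add: affine_dim_translate[OF V])
  qed
  then have dimW: "affine_dim W = affine_dim W1 + affine_dim W2"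
    unfolding W1(5) W2(5) using W1(4) W2(4) by (simp add: affine_dim_translate)
  have "W \<noteq> {}" using cpoly.subspace_0[OF V] by (auto simp: W_def)
  then obtain w where w: "w \<in> W" "waring_rank 2 w = minrank 2 W" by (rule minrank_attained)
  obtain x y where xy: "x \<in> W1" "y \<in> W2" "w = x + y" using W_elem[OF w(1)] by blast
  have "waring_rank 2 w = waring_rank 2 x + waring_rank 2 y"
    unfolding xy(3)
  proof (rule waring_rank_quadratic_add[OF _ _ AB])
    show "x \<in> forms 2 A" using xy(1) W1(3) DF by blast
    show "y \<in> forms 2 B" using xy(2) W2(3) DG by blast
  qed
  then have rkW: "minrank 2 W1 + minrank 2 W2 \<le> minrank 2 W"
    using w(2) minrank_le[OF xy(1), of 2] minrank_le[OF xy(2), of 2] by simp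
  have "0 \<notin> W"
  proof
    assume "0 \<in> W"
    then obtain x y where xy: "x \<in> W1" "y \<in> W2" "0 = x + y" using W_elem by blast
    then have "x = - y" by (simp add: eq_neg_iff_add_eq_0)
    moreover have "y \<in> forms 2 B" using xy(2) W2(3) DG by auto
    ultimately have "x \<in> forms 2 B" by (simp add: cpoly.subspace_neg[OF subspace_forms])
    moreover have "x \<in> forms 2 A" using xy(1) W1(3) DF by auto
    ultimately have "x = 0" using forms_disjoint[OF _ _ AB] by simp
    with xy(1) W1(2) show False by simp
  qed
  moreover have "W \<subseteq> Derivs d (F + G) 2"
  proof
    fix w assume "w \<in> W"
    then obtain x y where xy: "x \<in> W1" "y \<in> W2" "w = x + y" using W_elem by blast
    have "x \<in> Derivs d (F + G) 2"
      using xy(1) W1(3) Derivs_subset_Derivs_add[OF F G AB, of 2] d by auto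
    moreover have "y \<in> Derivs d (F + G) 2"
      using xy(2) W2(3) Derivs_subset_Derivs_add[OF G F, of 2] AB d by (auto simp: add.commute Int_commute)
    ultimately show "w \<in> Derivs d (F + G) 2"
      unfolding xy(3) Derivs_def by (rule cpoly.span_add)
  qed
  moreover have "affine_subspace W"
    unfolding affine_subspace_def using V W_def by blast
  ultimately have "affine_dim W + minrank 2 W \<in> derivs_bounds d (F + G)"
    unfolding derivs_bounds_def by blast
  then show ?thesis
    by (rule bexI[rotated]) (use dimW rkW W1(1) W2(1) in simp)
qed

lemma waring_rank_add_of_sharp_bounds:
  assumes F: "F \<in> forms d A" and G: "G \<in> forms d B" and AB: "A \<inter> B = {}" and d: "3 \<le> d"
    and nz: "F \<noteq> 0" "G \<noteq> 0"
    and sharp: "waring_rank d F = Max (derivs_bounds d F)" "waring_rank d G = Max (derivs_bounds d G)"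
  shows "waring_rank d (F + G) = waring_rank d F + waring_rank d G"
    and "waring_rank d (F + G) = Max (derivs_bounds d (F + G))"
proof -
  have FG: "is_form d F" "is_form d G"
    using F G by (simp_all add: forms_def)
  then have form: "is_form d (F + G)" by (rule is_form_add)
  have "2 \<le> d" using d by simp
  have "waring_rank d F \<in> derivs_bounds d F"
    unfolding sharp(1)
    by (rule Max_in[OF finite_derivs_bounds[OF FG(1) \<open>2 \<le> d\<close>] derivs_bounds_nonempty[OF FG(1) \<open>2 \<le> d\<close> nz(1)]])
  moreover have "waring_rank d G \<in> derivs_bounds d G"
    unfolding sharp(2)
    by (rule Max_in[OF finite_derivs_bounds[OF FG(2) \<open>2 \<le> d\<close>] derivs_bounds_nonempty[OF FG(2) \<open>2 \<le> d\<close> nz(2)]])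
  ultimately obtain e where e: "e \<in> derivs_bounds d (F + G)" "waring_rank d F + waring_rank d G \<le> e"
    using derivs_bounds_add[OF F G AB d] by blast
  have upper: "waring_rank d (F + G) \<le> waring_rank d F + waring_rank d G"
    using waring_rank_add_le[OF FG] d by simp
  have bound: "b \<le> waring_rank d (F + G)" if "b \<in> derivs_bounds d (F + G)" for b
    using derivs_bounds_le_waring_rank[OF form _ that] d by simp
  have "e = waring_rank d (F + G)"
    using bound[OF e(1)] upper e(2) by linarith
  with e(1) have "waring_rank d (F + G) \<in> derivs_bounds d (F + G)" by simp
  then show "waring_rank d (F + G) = Max (derivs_bounds d (F + G))"
    using finite_derivs_bounds[OF form \<open>2 \<le> d\<close>] bound by (intro Max_eqI[symmetric])
  show "waring_rank d (F + G) = waring_rank d F + waring_rank d G"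
    using bound[OF e(1)] upper e(2) by linarith
qed

theorem theorem2p9:
  fixes d k :: nat
    and X :: "nat \<Rightarrow> 'v set"
    and F :: "nat \<Rightarrow> 'v cpoly"
  assumes "d \<ge> 3"
    and "k \<ge> 1"
    and "\<And>i. i \<in> {1..k} \<Longrightarrow> finite (X i)"
    and "disjoint_family_on X {1..k}"
    and "\<And>i. i \<in> {1..k} \<Longrightarrow> poly_vars (F i) \<subseteq> X i"
    and "\<And>i. i \<in> {1..k} \<Longrightarrow> is_form d (F i)"
    and "\<And>i. i \<in> {1..k} \<Longrightarrow> F i \<noteq> 0"
    and "\<And>i. i \<in> {1..k} \<Longrightarrow>
      waring_rank d (F i) =
        Max {affine_dim W + minrank 2 W | W.
          affine_subspace W \<and> 0 \<notin> W \<and> W \<subseteq> Derivs d (F i) 2}"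
  shows "waring_rank d (\<Sum>i=1..k. F i) =
      Max {affine_dim W + minrank 2 W | W.
        affine_subspace W \<and> 0 \<notin> W \<and> W \<subseteq> Derivs d (\<Sum>i=1..k. F i) 2}
    \<and> waring_rank d (\<Sum>i=1..k. F i) = (\<Sum>i=1..k. waring_rank d (F i))"
proof -
  have forms: "F i \<in> forms d (X i)" if "i \<in> {1..k}" for i
    using assms(5,6)[OF that] by (simp add: forms_def)
  have sharp: "waring_rank d (F i) = Max (derivs_bounds d (F i))" if "i \<in> {1..k}" for i
    using assms(8)[OF that] by (simp add: derivs_bounds_def)
  have "(\<Sum>i=1..n. F i) \<in> forms d (\<Union>i\<in>{1..n}. X i) \<and> (\<Sum>i=1..n. F i) \<noteq> 0
      \<and> waring_rank d (\<Sum>i=1..n. F i) = Max (derivs_bounds d (\<Sum>i=1..n. F i))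
      \<and> waring_rank d (\<Sum>i=1..n. F i) = (\<Sum>i=1..n. waring_rank d (F i))"
    if "1 \<le> n" "n \<le> k" for n
    using that
  proof (induction rule: dec_induct)
    case base
    then show ?case using forms[of 1] sharp[of 1] assms(7)[of 1] by simp
  next
    case (step n)
    let ?S = "\<Sum>i=1..n. F i" and ?A = "\<Union>i\<in>{1..n}. X i"
    have IH: "?S \<in> forms d ?A" "?S \<noteq> 0" "waring_rank d ?S = Max (derivs_bounds d ?S)"
        "waring_rank d ?S = (\<Sum>i=1..n. waring_rank d (F i))"
      using step by auto
    have Suc: "Suc n \<in> {1..k}" using step.prems by simp
    have "X i \<inter> X (Suc n) = {}" if "i \<in> {1..n}" for i
      using that Suc by (intro disjoint_family_onD[OF assms(4)]) auto
    then have AX: "?A \<inter> X (Suc n) = {}" by blast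
    have sum: "(\<Sum>i=1..Suc n. F i) = ?S + F (Suc n)" by simp
    have "?A \<subseteq> (\<Union>i\<in>{1..Suc n}. X i)" "X (Suc n) \<subseteq> (\<Union>i\<in>{1..Suc n}. X i)"
      by force+
    then have "?S + F (Suc n) \<in> forms d (\<Union>i\<in>{1..Suc n}. X i)"
      using IH(1) forms[OF Suc] forms_mono by (intro cpoly.subspace_add[OF subspace_forms]) blast+
    moreover have "?S + F (Suc n) \<noteq> 0"
    proof
      assume "?S + F (Suc n) = 0"
      then have "?S = - F (Suc n)" by (simp add: eq_neg_iff_add_eq_0)
      then have "?S \<in> forms d (X (Suc n))"
        using cpoly.subspace_neg[OF subspace_forms forms[OF Suc]] by simp
      then have "?S = 0" using forms_disjoint[OF IH(1) _ AX] assms(1) by simp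
      with IH(2) show False by simp
    qed
    moreover note waring_rank_add_of_sharp_bounds[OF IH(1) forms[OF Suc] AX assms(1) IH(2) assms(7)[OF Suc] IH(3) sharp[OF Suc]]
    ultimately show ?case unfolding sum using IH(4) by simp
  qed
  from this[OF assms(2) order_refl] show ?thesis
    by (simp add: derivs_bounds_def)
qed

end
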